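(* If a vertex-transitive graph is isomorphic to the 3-arc graph of a connected arc-transitive graph of degree at least three, then it is hamiltonian.
   Context: All graphs are finite, undirected, without loops and without parallel edges. An arc of a graph $G$ is an ordered pair $uv$ of adjacent vertices $u,v$ (so $uv \neq vu$, and each edge gives two arcs); $A(G)$ is the set of all arcs of $G$. A graph is vertex-transitive if its automorphism group is transitive on its vertex set, and arc-transitive if its automorphism group is transitive on its set of arcs; a connected arc-transitive graph is regular, and its degree is the common degree of its vertices. A 3-arc of $G$ is a 4-tuple $(v,u,x,y)$ of vertices, possibly with $v=y$, such that both $(v,u,x)$ and $(u,x,y)$ are paths of $G$ (i.e. $v\ne x$, $u\neq y$, and $\{v,u\},\{u,x\},\{x,y\}$ are edges of $G$). The 3-arc graph $X(G)$ of $G$ is the graph with vertex set $A(G)$ in which the vertices corresponding to arcs $uv$ and $xy$ are adjacent if and only if $(v,u,x,y)$ is a 3-arc of $G$. A graph is hamiltonian if it contains a Hamilton cycle, i.e. a cycle containing every vertex. *)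

theory Defs
  imports "Graph_Theory.Graph_Theory"
begin

text \<open>Finite simple graphs are represented by the locale \<^locale>\<open>pair_graph\<close>: the edge \<open>{u, v}\<close> is
  the pair of arcs \<open>(u, v)\<close>, \<open>(v, u)\<close>, so \<open>parcs G\<close> is exactly the set of all arcs of \<open>G\<close>.
  The degree of a vertex is then its \<^const>\<open>out_degree\<close>.\<close>

definition automorphisms ::
  "('a, 'b) pre_digraph \<Rightarrow> ('a, 'b, 'a, 'b) digraph_isomorphism set" where
  "automorphisms G = {f. pre_digraph.digraph_isomorphism G f \<and> app_iso f G = G}"

definition vertex_transitive :: "('a, 'b) pre_digraph \<Rightarrow> bool" where
  "vertex_transitive G \<longleftrightarrow>
     (\<forall>u \<in> verts G. \<forall>v \<in> verts G. \<exists>f \<in> automorphisms G. iso_verts f u = v)"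

definition arc_transitive :: "('a, 'b) pre_digraph \<Rightarrow> bool" where
  "arc_transitive G \<longleftrightarrow>
     (\<forall>a \<in> arcs G. \<forall>b \<in> arcs G. \<exists>f \<in> automorphisms G. iso_arcs f a = b)"

text \<open>An isomorphism record carries the map on arcs separately from the map on vertices. Between
  graphs without parallel arcs the former is determined by the latter, so automorphisms are the
  usual ones.\<close>

lemma automorphism_iso_arcs:
  assumes "f \<in> automorphisms (with_proj G)" and "(u, v) \<in> parcs G"
  shows "iso_arcs f (u, v) = (iso_verts f u, iso_verts f v)"
proof -
  have eq: "app_iso f (with_proj G) = with_proj G"
    and iso: "pre_digraph.digraph_isomorphism (with_proj G) f"
    using assms(1) by (auto simp: automorphisms_def)
  have "iso_tail f = fst" "iso_head f = snd"
    using arg_cong[OF eq, of tail] arg_cong[OF eq, of head] by simp_all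
  with iso assms(2) show ?thesis
    by (auto simp: pre_digraph.digraph_isomorphism_def prod_eq_iff)
qed

definition regular_of_degree :: "('a, 'b) pre_digraph \<Rightarrow> nat \<Rightarrow> bool" where
  "regular_of_degree G d \<longleftrightarrow> (\<forall>v \<in> verts G. out_degree G v = d)"

definition three_arc :: "'a pair_pre_digraph \<Rightarrow> 'a \<Rightarrow> 'a \<Rightarrow> 'a \<Rightarrow> 'a \<Rightarrow> bool" where
  "three_arc G v u x y \<longleftrightarrow>
     (v, u) \<in> parcs G \<and> (u, x) \<in> parcs G \<and> (x, y) \<in> parcs G \<and> v \<noteq> x \<and> u \<noteq> y"

text \<open>Note the order of the vertices: \<open>(u, v)\<close> and \<open>(x, y)\<close> are adjacent when their tails \<open>u\<close>, \<open>x\<close>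
  are the two middle vertices of the 3-arc \<open>(v, u, x, y)\<close>.\<close>

definition three_arc_graph :: "'a pair_pre_digraph \<Rightarrow> ('a \<times> 'a) pair_pre_digraph" where
  "three_arc_graph G = \<lparr> pverts = parcs G,
     parcs = {((u, v), (x, y)) | u v x y. three_arc G v u x y} \<rparr>"

lemma pair_graph_three_arc_graph:
  assumes "pair_graph G"
  shows "pair_graph (three_arc_graph G)"
proof -
  interpret pair_graph G by fact
  have "parcs (three_arc_graph G) \<subseteq> parcs G \<times> parcs G"
    by (auto simp: three_arc_graph_def three_arc_def intro: arcs_symmetric)
  then have fin: "finite (parcs (three_arc_graph G))"
    using pair_finite_arcs finite_subset by blast
  show ?thesis
  proof unfold_locales
    show "finite (parcs (three_arc_graph G))" by (rule fin)
    show "finite (pverts (three_arc_graph G))"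
      by (simp add: three_arc_graph_def pair_finite_arcs)
    show "symmetric (with_proj (three_arc_graph G))"
      by (auto simp: three_arc_graph_def three_arc_def symmetric_def
          intro!: symI intro: arcs_symmetric)
  qed (auto simp: three_arc_graph_def three_arc_def intro: arcs_symmetric dest: no_loops')
qed

text \<open>In the library a closed walk \<open>(u, v), (v, u)\<close> that traverses one edge back and forth is a
  \<open>cycle\<close>; the bound on the length excludes it.\<close>

definition hamiltonian :: "('a, 'b) pre_digraph \<Rightarrow> bool" where
  "hamiltonian G \<longleftrightarrow>
     (\<exists>p. pre_digraph.cycle G p \<and> 3 \<le> length p \<and> tail G ` set p = verts G)"

end

theory Submission
  imports Defs "HOL-Combinatorics.Cycles"
begin

text \<open>The Hamilton cycle comes from drawing \<open>G\<close> on a closed, possibly non-orientable surface so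
  that there is a single face. Choose at every vertex \<open>u\<close> a cyclic order of its neighbours, given by
  a successor function \<open>rot u\<close>. There are as many corners at \<open>u\<close> (pairs of cyclically
  consecutive neighbours) as arcs with tail \<open>u\<close>; let the arc \<open>(u, v)\<close> stand for the corner between
  \<open>rot u v\<close> and \<open>rot u (rot u v)\<close>, its \<open>sides\<close>. A facial walk passes through one
  corner after another, so it becomes a cyclic sequence of arcs in which the predecessor and the
  successor of \<open>b\<close> have as tails, in some order, the two sides of \<open>b\<close>; such a sequence is called a
  \<open>closed_trail\<close>. As the degree is at least three, \<open>v\<close> is not a side of \<open>(u, v)\<close>. If
  \<open>(u, v)\<close> and \<open>(x, y)\<close> are consecutive, then \<open>x\<close> is a side of the former and \<open>u\<close> of the latter;
  hence \<open>x\<close> is a neighbour of \<open>u\<close> other than \<open>v\<close>, and \<open>u \<noteq> y\<close>, so that \<open>(v, u, x, y)\<close> is a 3-arc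
  (lemma \<open>sides_imp_three_arc_adjacent\<close>). A closed trail through all arcs is therefore a Hamilton
  cycle of the 3-arc graph.

  The orientable drawing with the given cyclic orders usually has several faces. Two
  different faces on the two sides of an edge \<open>{u, x}\<close> can be merged by twisting that edge: cut
  both facial walks where they run along the edge and reconnect them crosswise, traversing one of
  them backwards (lemma \<open>closed_trail_splice\<close>). Every corner keeps its pair of sides. Starting with
  one face and absorbing others in this manner, one stops only when the corners at a vertex that has
  been reached, hence by connectivity all corners, belong to the same closed trail (lemma
  \<open>covering_closed_trail_exists\<close>).\<close>

section \<open>Cyclic orders of the neighbours\<close>

text \<open>The last property expresses that \<open>\<tau>\<close> is a single cycle, the third one that this cycle is
  longer than two.\<close>

lemma cyclic_permutation_exists:
  assumes "finite A" and "3 \<le> card A"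
  obtains \<tau> where "\<tau> permutes A" and "\<And>v. v \<in> A \<Longrightarrow> \<tau> v \<noteq> v"
    and "\<And>v. v \<in> A \<Longrightarrow> \<tau> (\<tau> v) \<noteq> v"
    and "\<And>S. S \<subseteq> A \<Longrightarrow> S \<noteq> {} \<Longrightarrow> \<tau> ` S \<subseteq> S \<Longrightarrow> S = A"
proof -
  obtain xs where A: "set xs = A" and dist: "distinct xs"
    using finite_distinct_list[OF assms(1)] by blast
  define n where "n = length xs"
  have n: "3 \<le> n" using assms(2) dist by (simp add: n_def distinct_card flip: A)
  define \<tau> where "\<tau> = cycle_of_list xs"
  have step: "\<tau> (xs ! i) = xs ! (Suc i mod n)" if "i < n" for i
  proof -
    have "map \<tau> xs = rotate1 xs"
      using cyclic_rotation[OF dist, of 1] by (simp add: \<tau>_def)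
    then have "map \<tau> xs ! i = rotate1 xs ! i" by simp
    then show ?thesis using that by (simp add: nth_rotate1 n_def)
  qed
  have elem: "\<exists>i<n. v = xs ! i" if "v \<in> A" for v
    using that by (auto simp: n_def in_set_conv_nth simp flip: A)
  have inj: "xs ! i = xs ! j \<longleftrightarrow> i = j" if "i < n" "j < n" for i j
    using that dist by (simp add: n_def nth_eq_iff_index_eq)
  have iter: "(\<tau> ^^ k) (xs ! i) = xs ! ((i + k) mod n)" if "i < n" for i k
  proof (induction k)
    case (Suc k)
    then show ?case using step[of "(i + k) mod n"] n by (simp add: mod_Suc_eq)
  qed (use that in simp)
  have moved: "(\<tau> ^^ k) v \<noteq> v" if v: "v \<in> A" and k: "0 < k" "k < n" for v k
  proof -
    obtain i where i: "i < n" "v = xs ! i" using elem[OF v] by blast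
    have "(i + k) mod n \<noteq> i" using i(1) k by (auto simp: mod_if)
    then show ?thesis using iter[OF i(1), of k] inj[of "(i + k) mod n" i] i by simp
  qed
  show thesis
  proof (rule that[of \<tau>])
    show "\<tau> permutes A" using cycle_permutes[of xs] by (simp add: \<tau>_def A)
    show "\<tau> v \<noteq> v" if "v \<in> A" for v
      using moved[OF that, of 1] n by simp
    show "\<tau> (\<tau> v) \<noteq> v" if "v \<in> A" for v
      using moved[OF that, of 2] n by (simp add: numeral_2_eq_2)
    show "S = A" if S: "S \<subseteq> A" "S \<noteq> {}" "\<tau> ` S \<subseteq> S" for S
    proof
      have clos: "(\<tau> ^^ k) s \<in> S" if "s \<in> S" for s k
        using that S(3) by (induction k) auto
      obtain i where i: "i < n" "xs ! i \<in> S" using S elem by blast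
      show "A \<subseteq> S"
      proof
        fix v assume "v \<in> A"
        then obtain j where j: "j < n" "v = xs ! j" using elem by blast
        have "(i + (n - i + j)) mod n = j" using i(1) j(1) by simp
        then show "v \<in> S" using clos[OF i(2), of "n - i + j"] iter[OF i(1)] j by metis
      qed
    qed (rule S(1))
  qed
qed

text \<open>The combinatorial data of a drawing of \<open>G\<close> on an oriented surface.\<close>

locale rotation_system = pair_graph G for G :: "'a pair_pre_digraph" +
  fixes rot :: "'a \<Rightarrow> 'a \<Rightarrow> 'a"
  assumes rot_permutes: "u \<in> pverts G \<Longrightarrow> rot u permutes {v. (u, v) \<in> parcs G}"
    and rot_neq: "(u, v) \<in> parcs G \<Longrightarrow> rot u v \<noteq> v"
    and rot_rot_neq: "(u, v) \<in> parcs G \<Longrightarrow> rot u (rot u v) \<noteq> v"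
    and rot_transitive: "u \<in> pverts G \<Longrightarrow> S \<subseteq> {v. (u, v) \<in> parcs G} \<Longrightarrow> S \<noteq> {} \<Longrightarrow>
      rot u ` S \<subseteq> S \<Longrightarrow> S = {v. (u, v) \<in> parcs G}"

lemma rotation_system_exists:
  assumes "pair_graph G" and "\<And>v. v \<in> pverts G \<Longrightarrow> 3 \<le> out_degree (with_proj G) v"
  obtains rot where "rotation_system G rot"
proof -
  interpret pair_graph G by fact
  have "\<exists>\<tau>. \<tau> permutes N \<and> (\<forall>v\<in>N. \<tau> v \<noteq> v \<and> \<tau> (\<tau> v) \<noteq> v) \<and>
      (\<forall>S. S \<subseteq> N \<longrightarrow> S \<noteq> {} \<longrightarrow> \<tau> ` S \<subseteq> S \<longrightarrow> S = N)"
    if u: "u \<in> pverts G" and N: "N = {v. (u, v) \<in> parcs G}" for u N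
  proof -
    have "out_arcs (with_proj G) u = Pair u ` N" by (auto simp: out_arcs_def N)
    then have "card N = out_degree (with_proj G) u"
      by (simp add: out_degree_def card_image inj_on_def)
    moreover have "finite N"
      by (rule finite_subset[OF _ pair_finite_verts]) (auto simp: N dest: in_arcsD2)
    ultimately obtain \<tau> where "\<tau> permutes N" "\<And>v. v \<in> N \<Longrightarrow> \<tau> v \<noteq> v"
        "\<And>v. v \<in> N \<Longrightarrow> \<tau> (\<tau> v) \<noteq> v"
        "\<And>S. S \<subseteq> N \<Longrightarrow> S \<noteq> {} \<Longrightarrow> \<tau> ` S \<subseteq> S \<Longrightarrow> S = N"
      using cyclic_permutation_exists[of N] assms(2)[OF u] by metis
    then show ?thesis by blast
  qed
  then obtain rot where rot: "\<And>u N. u \<in> pverts G \<Longrightarrow> N = {v. (u, v) \<in> parcs G} \<Longrightarrow>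
      rot u permutes N \<and> (\<forall>v\<in>N. rot u v \<noteq> v \<and> rot u (rot u v) \<noteq> v) \<and>
      (\<forall>S. S \<subseteq> N \<longrightarrow> S \<noteq> {} \<longrightarrow> rot u ` S \<subseteq> S \<longrightarrow> S = N)"
    by metis
  have "rotation_system G rot"
    using rot[OF _ refl] in_arcsD1 by unfold_locales auto
  then show thesis by (rule that)
qed

context rotation_system
begin

lemma rot_arc: "(u, v) \<in> parcs G \<Longrightarrow> (u, rot u v) \<in> parcs G"
  using permutes_in_image[OF rot_permutes, of u v] in_arcsD1 by fastforce

lemma inv_rot_arc: "(u, v) \<in> parcs G \<Longrightarrow> (u, inv (rot u) v) \<in> parcs G"
  using permutes_in_image[OF permutes_inv[OF rot_permutes], of u v] in_arcsD1 by fastforce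

lemma rot_inv_rot: "(u, v) \<in> parcs G \<Longrightarrow> rot u (inv (rot u) v) = v"
  using permutes_inverses(1)[OF rot_permutes] in_arcsD1 by fastforce

lemma rot_inj: "u \<in> pverts G \<Longrightarrow> rot u v = rot u w \<Longrightarrow> v = w"
  using permutes_inj[OF rot_permutes] by (auto dest: injD)

section \<open>Closed trails of corners\<close>

text \<open>The two neighbours of \<open>fst b\<close> between which the corner represented by the arc \<open>b\<close> lies.
  Labelling this corner by \<open>snd b\<close>, which precedes both of them in the cyclic order, is a
  bijection between arcs and corners and avoids the sides themselves.\<close>

definition sides :: "'a \<times> 'a \<Rightarrow> 'a set" where
  "sides b = {rot (fst b) (snd b), rot (fst b) (rot (fst b) (snd b))}"

text \<open>A walk that arrives from the vertex \<open>w\<close>, passes through the corners in \<open>xs\<close>, and leaves towards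
  the vertex \<open>z\<close>. Only the tails of adjacent corners matter, not the corners themselves; this is why
  walks can later be cut and reconnected along an edge of \<open>G\<close>.\<close>

fun follows :: "'a \<Rightarrow> ('a \<times> 'a) list \<Rightarrow> 'a \<Rightarrow> bool" where
  "follows w [] z \<longleftrightarrow> True"
| "follows w (b # bs) z \<longleftrightarrow>
     sides b = {w, if bs = [] then z else fst (hd bs)} \<and> follows (fst b) bs z"

lemma follows_append:
  assumes "xs \<noteq> []" and "ys \<noteq> []"
  shows "follows w (xs @ ys) z \<longleftrightarrow>
    follows w xs (fst (hd ys)) \<and> follows (fst (last xs)) ys z"
  using assms by (induction w xs z rule: follows.induct) auto

lemma follows_rev: "follows w xs z \<Longrightarrow> follows z (rev xs) w"
proof (induction w xs z rule: follows.induct)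
  case (2 w b bs z)
  show ?case
  proof (cases "bs = []")
    case False
    then show ?thesis
      using 2 by (auto simp: follows_append last_rev insert_commute)
  qed (use 2 in \<open>auto simp: insert_commute\<close>)
qed simp

definition closed_trail :: "('a \<times> 'a) list \<Rightarrow> bool" where
  "closed_trail xs \<longleftrightarrow> xs \<noteq> [] \<and> distinct xs \<and> set xs \<subseteq> parcs G \<and>
     follows (fst (last xs)) xs (fst (hd xs))"

lemma closed_trail_rotate: "closed_trail (xs @ ys) \<Longrightarrow> closed_trail (ys @ xs)"
  by (cases "xs = []"; cases "ys = []") (auto simp: closed_trail_def follows_append)

lemma closed_trail_rev: "closed_trail xs \<Longrightarrow> closed_trail (rev xs)"
  by (auto simp: closed_trail_def last_rev hd_rev intro: follows_rev)

text \<open>The predecessor and the successor of \<open>b\<close> have the two sides of \<open>b\<close> as tails. Rotating \<open>b\<close> to the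
  front, and reversing the trail if necessary, puts the prescribed one of them at the end.\<close>

lemma closed_trail_orient:
  assumes "closed_trail xs" and "b \<in> set xs" and "x \<in> sides b"
  obtains ys where "closed_trail ys" and "set ys = set xs" and "hd ys = b" and "fst (last ys) = x"
proof -
  obtain as bs where xs: "xs = as @ b # bs" using assms(2) by (meson split_list)
  define cs where "cs = bs @ as"
  have closed: "closed_trail (b # cs)" and set: "set (b # cs) = set xs"
    using closed_trail_rotate[of as "b # bs"] assms(1) by (auto simp: xs cs_def)
  have rev: "closed_trail (b # rev cs)"
    using closed_trail_rotate[of "rev cs" "[b]"] closed_trail_rev[OF closed] by simp
  have "x = fst (last (b # cs)) \<or> x = fst (last (b # rev cs))"
    using closed assms(3) by (auto simp: closed_trail_def last_rev split: if_splits)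
  then show thesis
    using that[of "b # cs"] that[of "b # rev cs"] closed rev set by auto
qed

text \<open>Both trails are cut where they use the same edge \<open>{u, x}\<close> of \<open>G\<close>: the first one passes from its
  last corner, at \<open>x\<close>, to its first corner, at \<open>u\<close>, and the second one from \<open>u\<close> to \<open>x\<close>. After the
  reversal of the second trail the four ends fit together, and each corner at a cut still has a
  corner with the same tail next to it.\<close>

lemma closed_trail_splice:
  assumes "closed_trail xs" and "closed_trail ys" and "set xs \<inter> set ys = {}"
    and "fst (hd xs) = fst (last ys)" and "fst (last xs) = fst (hd ys)"
  shows "closed_trail (xs @ rev ys)"
  using assms follows_rev[of "fst (last ys)" ys "fst (hd ys)"]
  by (auto simp: closed_trail_def follows_append hd_rev last_rev)

section \<open>Facial walks\<close>

text \<open>The face permutation of the orientable drawing. From the corner \<open>b\<close> the walk moves along the edge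
  to the first side \<open>x\<close> of \<open>b\<close>; the next corner at \<open>x\<close> is the one whose second side is the vertex
  \<open>fst b\<close> where the walk comes from, so its label is two steps before \<open>fst b\<close> around \<open>x\<close>.\<close>

definition face :: "'a \<times> 'a \<Rightarrow> 'a \<times> 'a" where
  "face b = (if b \<in> parcs G then
     (let x = rot (fst b) (snd b) in (x, inv (rot x) (inv (rot x) (fst b)))) else b)"

lemma face_arc:
  assumes "b \<in> parcs G"
  shows "face b \<in> parcs G" and "fst (face b) = rot (fst b) (snd b)"
    and "rot (fst (face b)) (rot (fst (face b)) (snd (face b))) = fst b"
proof -
  obtain u v where b: "b = (u, v)" by force
  define x where "x = rot u v"
  have ux: "(u, x) \<in> parcs G" using rot_arc assms by (simp add: b x_def)
  have xu: "(x, u) \<in> parcs G" using ux by (rule arcs_symmetric)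
  have eq: "face b = (x, inv (rot x) (inv (rot x) u))"
    using assms by (simp add: face_def b x_def Let_def)
  show "face b \<in> parcs G" unfolding eq using xu by (intro inv_rot_arc)
  show "fst (face b) = rot (fst b) (snd b)" unfolding eq by (simp add: b x_def)
  show "rot (fst (face b)) (rot (fst (face b)) (snd (face b))) = fst b"
    unfolding eq using rot_inv_rot[OF xu] rot_inv_rot[OF inv_rot_arc[OF xu]] by (simp add: b)
qed

lemma face_permutes: "face permutes parcs G"
proof (rule bij_imp_permutes)
  have "inj_on face (parcs G)"
  proof (rule inj_onI)
    fix b c assume b: "b \<in> parcs G" and c: "c \<in> parcs G" and eq: "face b = face c"
    have tail: "fst b = fst c"
      using face_arc(3)[OF b] face_arc(3)[OF c] unfolding eq by (rule trans[OF sym])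
    have "rot (fst b) (snd b) = rot (fst b) (snd c)"
      using face_arc(2)[OF b] face_arc(2)[OF c] unfolding eq tail by (rule trans[OF sym])
    then have "snd b = snd c" by (rule rot_inj[OF arc_fst_in_verts[OF b]])
    with tail show "b = c" by (rule prod_eqI)
  qed
  moreover have "face ` parcs G \<subseteq> parcs G" by (rule image_subsetI) (rule face_arc(1))
  ultimately show "bij_betw face (parcs G) (parcs G)"
    using endo_inj_surj[OF pair_finite_arcs] unfolding bij_betw_def by (intro conjI)
qed (simp only: face_def if_False)

lemma sides_face: "b \<in> parcs G \<Longrightarrow> sides (face b) = {fst b, fst (face (face b))}"
  using face_arc(3)[of b] face_arc(2)[OF face_arc(1), of b] by (auto simp: sides_def)

lemma follows_map_upt:
  assumes "\<And>i. sides (f (Suc i)) = {fst (f i), fst (f (Suc (Suc i)))}"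
  shows "follows (fst (f 0)) (map f [1..<Suc n]) (fst (f (Suc n)))"
proof (induction n)
  case (Suc n)
  show ?case
  proof (cases "n = 0")
    case True
    then show ?thesis using assms[of 0] by simp
  next
    case False
    define xs where "xs = map f [1..<Suc n]"
    have "xs \<noteq> []" and "last xs = f n" using False by (simp_all add: xs_def)
    moreover have "follows (fst (f 0)) xs (fst (f (Suc n)))" using Suc.IH by (simp only: xs_def)
    ultimately have "follows (fst (f 0)) (xs @ [f (Suc n)]) (fst (f (Suc (Suc n))))"
      using assms[of n] by (simp add: follows_append)
    then show ?thesis by (simp add: xs_def)
  qed
qed simp

text \<open>The orbit of \<open>b\<close> under the face permutation, listed from \<open>face b\<close> round to \<open>b\<close>. The last
  property makes a set that is closed under \<open>face\<close> and avoids \<open>b\<close> disjoint from the orbit.\<close>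

lemma facial_trail:
  assumes "b \<in> parcs G"
  obtains ys where "closed_trail ys" and "hd ys = face b" and "last ys = b"
    and "face ` set ys \<subseteq> set ys" and "\<And>y. y \<in> set ys \<Longrightarrow> \<exists>k. (face ^^ k) y = b"
proof -
  have perm: "permutation face"
    using face_permutes pair_finite_arcs permutation_permutes by blast
  define n where "n = least_power face b"
  define f where "f = (\<lambda>i. (face ^^ i) b)"
  have f_Suc: "f (Suc i) = face (f i)" for i by (simp add: f_def)
  have per: "f n = b" and n: "0 < n"
    using least_power_of_permutation[OF perm, of b] by (simp_all add: f_def n_def)
  define ys where "ys = map f [1..<Suc n]"
  \<comment> \<open>The first form of \<open>ys\<close> exposes its walk structure; this one gives distinctness.\<close>
  have ys: "ys = map face (support face b)"
    unfolding ys_def n_def[symmetric] by (simp add: f_def map_Suc_upt[symmetric] del: upt_Suc)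
  have ys0: "ys \<noteq> []" using n by (simp add: ys_def)
  have last: "last ys = b" using n per by (simp add: ys_def)
  have "hd ys = f 1" using n by (simp add: ys_def hd_map del: upt_Suc)
  then have hd: "hd ys = face b" by (simp add: f_def)
  have arc: "f i \<in> parcs G" for i
    by (induction i) (use assms face_arc(1) in \<open>auto simp: f_def\<close>)
  have "closed_trail ys"
    unfolding closed_trail_def
  proof (intro conjI)
    show "distinct ys"
      using cycle_of_permutation[OF perm, of b] permutes_inj[OF face_permutes]
      by (simp only: ys distinct_map[of face]) (auto intro: inj_on_subset)
    show "set ys \<subseteq> parcs G" using arc by (auto simp: ys_def)
    have "follows (fst (f 0)) ys (fst (f (Suc n)))"
      unfolding ys_def by (rule follows_map_upt) (simp add: f_Suc sides_face arc)
    moreover have "f 0 = b" "f (Suc n) = face b" using per by (simp_all add: f_def)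
    ultimately show "follows (fst (last ys)) ys (fst (hd ys))" by (simp add: hd last)
  qed (rule ys0)
  moreover have "face ` set ys \<subseteq> set ys"
  proof
    fix y assume "y \<in> face ` set ys"
    then obtain i where i: "1 \<le> i" "i \<le> n" "y = f (Suc i)" by (auto simp: ys_def f_Suc)
    then have "y = f (if i = n then 1 else Suc i)" using per by (auto simp: f_Suc f_def)
    then show "y \<in> set ys" using i n by (auto simp: ys_def simp del: upt_Suc)
  qed
  moreover have "\<exists>k. (face ^^ k) y = b" if y: "y \<in> set ys" for y
  proof -
    obtain i where i: "i \<le> n" "y = f i"
      using y by (fastforce simp: ys_def less_Suc_eq_le simp del: upt_Suc)
    have "(face ^^ (n - i)) (f i) = f (n - i + i)"
      unfolding f_def by (simp only: funpow_add o_apply)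
    then show ?thesis using i per by auto
  qed
  ultimately show thesis using that hd last by blast
qed

section \<open>Merging all faces into one closed trail\<close>

text \<open>The corners \<open>(u, v)\<close> and \<open>(u, rot u v)\<close> share the side \<open>x = rot u (rot u v)\<close>, that is, they lie on
  different sides of the edge \<open>{u, x}\<close>. If only the first one is on the trail, then the face of
  the second one, which is disjoint from the trail since the trail is a union of faces, can be
  spliced in across this edge.\<close>

lemma face_closed_trail_extend:
  assumes xs: "closed_trail xs" "face ` set xs \<subseteq> set xs"
    and b: "(u, v) \<in> set xs" and b': "(u, rot u v) \<notin> set xs"
  obtains zs where "closed_trail zs" and "face ` set zs \<subseteq> set zs" and "length xs < length zs"
proof -
  have arc: "(u, rot u v) \<in> parcs G" using xs(1) b rot_arc by (auto simp: closed_trail_def)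
  obtain ys where ys: "closed_trail ys" "hd ys = face (u, rot u v)" "last ys = (u, rot u v)"
      "face ` set ys \<subseteq> set ys" "\<And>y. y \<in> set ys \<Longrightarrow> \<exists>k. (face ^^ k) y = (u, rot u v)"
    using facial_trail[OF arc] by metis
  have iter: "(face ^^ k) y \<in> set xs" if "y \<in> set xs" for k y
    using that xs(2) by (induction k) auto
  have "rot u (rot u v) \<in> sides (u, v)" by (simp add: sides_def)
  then obtain xs' where xs': "closed_trail xs'" "set xs' = set xs" "hd xs' = (u, v)"
      "fst (last xs') = rot u (rot u v)"
    using closed_trail_orient[OF xs(1) b] by blast
  have "set xs' \<inter> set ys = {}"
  proof (rule ccontr)
    assume "set xs' \<inter> set ys \<noteq> {}"
    then obtain y where "y \<in> set xs" "y \<in> set ys" using xs' by auto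
    then show False using ys(5) iter b' by metis
  qed
  then have "closed_trail (xs' @ rev ys)"
    using xs' ys face_arc[OF arc] by (intro closed_trail_splice) auto
  moreover have "length xs = length xs'"
    using xs(1) xs'(1,2) by (metis closed_trail_def distinct_card)
  moreover have "face ` set (xs' @ rev ys) \<subseteq> set (xs' @ rev ys)"
    using ys(4) xs(2) xs'(2) by auto
  moreover have "ys \<noteq> []" using ys(1) by (simp add: closed_trail_def)
  ultimately show thesis using that[of "xs' @ rev ys"] by simp
qed

text \<open>A longest closed trail that is a union of faces cannot be extended, so with one corner at a vertex
  it contains the next corner there, and by cyclicity all of them. The faces of these corners lead
  to all neighbours of the vertex, and connectivity finishes the argument.\<close>

lemma covering_closed_trail_exists:
  assumes "Digraph_Component.connected (with_proj G)" and "parcs G \<noteq> {}"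
  obtains xs where "closed_trail xs" and "set xs = parcs G"
proof -
  define P where "P xs \<longleftrightarrow> closed_trail xs \<and> face ` set xs \<subseteq> set xs" for xs
  obtain a where "a \<in> parcs G" using assms(2) by blast
  then obtain xs0 where "P xs0" using facial_trail P_def by metis
  moreover have "length xs \<le> card (parcs G)" if "P xs" for xs
    using that card_mono[OF pair_finite_arcs] by (metis P_def closed_trail_def distinct_card)
  ultimately obtain xs where P: "P xs" and max: "\<And>zs. P zs \<Longrightarrow> length zs \<le> length xs"
    using ex_has_greatest_nat[of P xs0 length] by (metis le_imp_less_Suc)
  have xs: "closed_trail xs" "face ` set xs \<subseteq> set xs" using P by (auto simp: P_def)
  have sub: "set xs \<subseteq> parcs G" and "xs \<noteq> []" using xs(1) by (auto simp: closed_trail_def)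
  have star: "(u, w) \<in> set xs" if uv: "(u, v) \<in> set xs" and uw: "(u, w) \<in> parcs G" for u v w
  proof -
    define S where "S = {v. (u, v) \<in> set xs}"
    have "rot u ` S \<subseteq> S"
    proof (rule image_subsetI, rule ccontr)
      fix v assume "v \<in> S" "rot u v \<notin> S"
      then have "(u, v) \<in> set xs" "(u, rot u v) \<notin> set xs" by (simp_all add: S_def)
      then obtain zs where "closed_trail zs" "face ` set zs \<subseteq> set zs" "length xs < length zs"
        by (rule face_closed_trail_extend[OF xs])
      then show False using max[of zs] by (simp add: P_def)
    qed
    moreover have "u \<in> pverts G" using uv sub by (blast intro: in_arcsD1)
    moreover have "S \<subseteq> {v. (u, v) \<in> parcs G}" "S \<noteq> {}" using uv sub by (auto simp: S_def)
    ultimately have "S = {v. (u, v) \<in> parcs G}" using rot_transitive by metis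
    then have "w \<in> S" using uw by simp
    then show ?thesis by (simp add: S_def)
  qed
  have neighbour: "\<exists>z. (w, z) \<in> set xs" if uv: "(u, v) \<in> set xs" and uw: "(u, w) \<in> parcs G" for u v w
  proof -
    define c where "c = face (u, inv (rot u) w)"
    \<comment> \<open>This corner has \<open>w\<close> as its first side, so the next corner on its face lies at \<open>w\<close>.\<close>
    have "(u, inv (rot u) w) \<in> set xs" by (rule star[OF uv inv_rot_arc[OF uw]])
    then have "(fst c, snd c) \<in> set xs" using xs(2) by (auto simp: c_def)
    moreover have "fst c = w"
      using face_arc(2)[OF inv_rot_arc[OF uw]] rot_inv_rot[OF uw] by (simp add: c_def)
    ultimately show ?thesis by metis
  qed
  have "parcs G \<subseteq> set xs"
  proof
    fix b assume b: "b \<in> parcs G"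
    obtain a where a: "a \<in> set xs" using \<open>xs \<noteq> []\<close> by (cases xs) auto
    have "strongly_connected (with_proj G)"
      using assms(1) pair_sym_arcs by (rule symmetric_connected_imp_strongly_connected[rotated])
    then have "fst a \<rightarrow>\<^sup>*\<^bsub>with_proj G\<^esub> fst b"
      using a b sub by (auto simp: strongly_connected_def dest: arc_fst_in_verts)
    then have "\<exists>z. (fst b, z) \<in> set xs"
    proof (induction rule: reachable_induct)
      case base
      show ?case using a by (intro exI[of _ "snd a"]) simp
    next
      case (step x y)
      then show ?case using neighbour by auto
    qed
    then obtain z where "(fst b, z) \<in> set xs" by blast
    then have "(fst b, snd b) \<in> set xs" by (rule star) (simp add: b)
    then show "b \<in> set xs" by simp
  qed
  then show thesis using that xs(1) sub by blast
qed

section \<open>Closed trails as cycles of the 3-arc graph\<close>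

lemma sides_arc:
  assumes "b \<in> parcs G" and "x \<in> sides b"
  shows "(fst b, x) \<in> parcs G" and "x \<noteq> snd b"
proof -
  have b: "(fst b, snd b) \<in> parcs G" using assms(1) by simp
  have x: "x = rot (fst b) (snd b) \<or> x = rot (fst b) (rot (fst b) (snd b))"
    using assms(2) by (auto simp: sides_def)
  show "(fst b, x) \<in> parcs G" using x rot_arc[OF b] rot_arc[OF rot_arc[OF b]] by metis
  show "x \<noteq> snd b" using x rot_neq[OF b] rot_rot_neq[OF b] by metis
qed

lemma sides_imp_three_arc_adjacent:
  assumes "b \<in> parcs G" "c \<in> parcs G" "fst c \<in> sides b" "fst b \<in> sides c"
  shows "(b, c) \<in> parcs (three_arc_graph G)"
proof -
  have "three_arc G (snd b) (fst b) (fst c) (snd c)"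
    using assms sides_arc[OF assms(1,3)] sides_arc[OF assms(2,4)]
    by (simp add: three_arc_def arcs_symmetric)
  then show ?thesis by (cases b; cases c) (simp add: three_arc_graph_def)
qed

lemma follows_imp_sides: "follows w xs z \<Longrightarrow> xs \<noteq> [] \<Longrightarrow> w \<in> sides (hd xs)"
  by (cases xs) auto

lemma follows_successively_adjacent:
  "follows w xs z \<Longrightarrow> set xs \<subseteq> parcs G \<Longrightarrow>
    successively (\<lambda>b c. (b, c) \<in> parcs (three_arc_graph G)) xs"
proof (induction w xs z rule: follows.induct)
  case (2 w b bs z)
  show ?case
  proof (cases "bs = []")
    case False
    have "fst b \<in> sides (hd bs)" using 2 False by (intro follows_imp_sides) auto
    moreover have "fst (hd bs) \<in> sides b" using 2 False by auto
    ultimately have "(b, hd bs) \<in> parcs (three_arc_graph G)"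
      using 2 False by (intro sides_imp_three_arc_adjacent) auto
    then show ?thesis using 2 False by (simp add: successively_Cons)
  qed simp
qed simp

lemma closed_trail_three_arc_cycle:
  assumes "closed_trail xs"
  shows "successively (\<lambda>b c. (b, c) \<in> parcs (three_arc_graph G)) (xs @ [hd xs])"
proof -
  have xs: "xs \<noteq> []" "follows (fst (last xs)) xs (fst (hd xs))" "set xs \<subseteq> parcs G"
    using assms by (auto simp: closed_trail_def)
  have "fst (last xs) \<in> sides (hd xs)" using xs by (intro follows_imp_sides)
  moreover have "fst (hd xs) \<in> sides (last xs)"
    using follows_imp_sides[OF follows_rev[OF xs(2)]] xs(1) by (simp add: hd_rev)
  ultimately have "(last xs, hd xs) \<in> parcs (three_arc_graph G)"
    using xs by (intro sides_imp_three_arc_adjacent) auto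
  then show ?thesis
    using follows_successively_adjacent[OF xs(2,3)] xs(1) by (simp add: successively_append_iff)
qed

end

section \<open>Hamilton cycles as lists of vertices\<close>

lemma pcas_zip: "pcas v (zip (v # vs) (vs @ [z])) z"
  by (induction vs arbitrary: v) auto

lemma pawalk_verts_zip: "pawalk_verts v (zip (v # vs) (vs @ [z])) = v # vs @ [z]"
  by (induction vs arbitrary: v) auto

lemma zip_subset_if_successively:
  "successively (\<lambda>x y. (x, y) \<in> R) (v # vs @ [z]) \<Longrightarrow> set (zip (v # vs) (vs @ [z])) \<subseteq> R"
  by (induction vs arbitrary: v) auto

lemma hamiltonian_if_cyclic_list:
  assumes "pair_graph H" and "distinct vs" and "set vs = pverts H" and "3 \<le> length vs"
    and "successively (\<lambda>x y. (x, y) \<in> parcs H) (vs @ [hd vs])"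
  shows "hamiltonian (with_proj H)"
proof -
  interpret pair_graph H by fact
  obtain v ws where vs: "vs = v # ws" using assms(4) by (cases vs) auto
  define p where "p = zip (v # ws) (ws @ [v])"
  have "fst ` set p = set (map fst p)" by simp
  also have "\<dots> = set vs" by (simp add: p_def vs del: set_map)
  finally have "fst ` set p = pverts H" using assms(3) by simp
  moreover have "cycle p"
    unfolding cycle_def awalk_def
    using assms zip_subset_if_successively[of "parcs H" v ws v]
    by (auto simp: p_def vs pcas_zip pawalk_verts_zip simp del: zip_Cons_Cons intro!: exI[of _ v])
  moreover have "3 \<le> length p" using assms(4) by (simp add: p_def vs)
  ultimately show ?thesis unfolding hamiltonian_def by auto
qed

lemma digraph_iso_pair_bij:
  assumes "digraph_iso (with_proj H) (with_proj X)"
  obtains g where "bij_betw g (pverts X) (pverts H)"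
    and "\<And>a b. (a, b) \<in> parcs X \<Longrightarrow> (g a, g b) \<in> parcs H"
proof -
  obtain f where f: "pre_digraph.digraph_isomorphism (with_proj H) f"
      and X: "with_proj X = app_iso f (with_proj H)"
    using assms by (auto simp: digraph_iso_def)
  have V: "pverts X = iso_verts f ` pverts H" using arg_cong[OF X, of verts] by simp
  have E: "parcs X = iso_arcs f ` parcs H" using arg_cong[OF X, of arcs] by simp
  have th: "iso_tail f = fst" "iso_head f = snd"
    using arg_cong[OF X, of tail] arg_cong[OF X, of head] by simp_all
  have wf: "wf_digraph (with_proj H)" and inj: "inj_on (iso_verts f) (pverts H)"
    and arc: "\<And>e. e \<in> parcs H \<Longrightarrow> iso_arcs f e = (iso_verts f (fst e), iso_verts f (snd e))"
    using f th by (auto simp: pre_digraph.digraph_isomorphism_def prod_eq_iff)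
  define g where "g = inv_into (pverts H) (iso_verts f)"
  have g: "g (iso_verts f v) = v" if "v \<in> pverts H" for v
    using that inj by (simp add: g_def)
  have "bij_betw g (pverts X) (pverts H)"
    using inj by (auto simp: V g_def intro: bij_betw_inv_into bij_betw_imageI)
  moreover have "(g a, g b) \<in> parcs H" if ab: "(a, b) \<in> parcs X" for a b
  proof -
    obtain e where e: "e \<in> parcs H" "(a, b) = (iso_verts f (fst e), iso_verts f (snd e))"
      using ab arc by (auto simp: E)
    then show ?thesis
      using wf_digraph.tail_in_verts[OF wf, of e] wf_digraph.head_in_verts[OF wf, of e] g by simp
  qed
  ultimately show thesis by (rule that)
qed

theorem corollary6:
  fixes H :: "'b pair_pre_digraph" and G :: "'a pair_pre_digraph" and d :: nat
  assumes "pair_graph H"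
    and "vertex_transitive (with_proj H)"
    and "pair_graph G"
    and "Digraph_Component.connected (with_proj G)"
    and "arc_transitive (with_proj G)"
    and "regular_of_degree (with_proj G) d"
    and "d \<ge> 3"
    and "digraph_iso (with_proj H) (with_proj (three_arc_graph G))"
  shows "hamiltonian (with_proj H)"
proof -
  have deg: "3 \<le> out_degree (with_proj G) v" if "v \<in> pverts G" for v
    using assms(6,7) that by (simp add: regular_of_degree_def)
  obtain rot where "rotation_system G rot"
    using rotation_system_exists[OF assms(3) deg] by blast
  then interpret rotation_system G rot .
  obtain v where v: "v \<in> pverts G"
    using assms(4) by (auto simp: Digraph_Component.connected_conv)
  have "card (out_arcs (with_proj G) v) \<le> card (parcs G)"
    by (rule card_mono) (auto simp: pair_finite_arcs)
  then have card: "3 \<le> card (parcs G)" using deg[OF v] by (simp add: out_degree_def)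
  then have "parcs G \<noteq> {}" by auto
  then obtain xs where xs: "closed_trail xs" "set xs = parcs G"
    using covering_closed_trail_exists[OF assms(4)] by blast
  then have dist: "distinct xs" and len: "3 \<le> length xs" and "xs \<noteq> []"
    using card by (auto simp: closed_trail_def simp flip: distinct_card)
  obtain g where g: "bij_betw g (pverts (three_arc_graph G)) (pverts H)"
      and adj: "\<And>a b. (a, b) \<in> parcs (three_arc_graph G) \<Longrightarrow> (g a, g b) \<in> parcs H"
    using digraph_iso_pair_bij[OF assms(8)] by blast
  have set: "set xs = pverts (three_arc_graph G)" by (simp add: xs three_arc_graph_def)
  show ?thesis
  proof (rule hamiltonian_if_cyclic_list[OF assms(1), of "map g xs"])
    show "distinct (map g xs)" "set (map g xs) = pverts H"
      using g dist by (auto simp: distinct_map bij_betw_def set)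
    show "3 \<le> length (map g xs)" using len by simp
    have "successively (\<lambda>b c. (g b, g c) \<in> parcs H) (xs @ [hd xs])"
      using closed_trail_three_arc_cycle[OF xs(1)] adj by (rule successively_mono)
    then have "successively (\<lambda>x y. (x, y) \<in> parcs H) (map g (xs @ [hd xs]))"
      by (simp only: successively_map)
    then show "successively (\<lambda>x y. (x, y) \<in> parcs H) (map g xs @ [hd (map g xs)])"
      using \<open>xs \<noteq> []\<close> by (simp add: hd_map)
  qed
qed

end
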